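(* Let $F=\{f_n\}_{n=1}^\infty$ be a Bessel sequence in a Hilbert space $\mathcal{H}$ which is represented by $T_0$, and let $M=\{f_n+f_{n+1}\}_{n=1}^\infty$ be a frame for $\mathcal{H}$. Let $B_F$ be a Bessel bound for $F$ and $A_M$ a lower frame bound for $M$. Then $\ker T_M\subseteq\ker T_{\mathcal{T}_L^2F}$ if and only if $T:=T_0|_{\operatorname{span}\{f_n+f_{n+1}\}_{n=1}^\infty}$ is bounded with $\|T\|\leqslant\sqrt{\frac{B_F}{A_M}}$.
   Context: A sequence $G=\{g_n\}_{n=1}^\infty$ in $\mathcal{H}$ is a frame for $\mathcal{H}$ with lower bound $A>0$ and upper bound $B>0$ if $A\|f\|^2\leqslant\sum_{n=1}^\infty|\langle f,g_n\rangle|^2\leqslant B\|f\|^2$ for all $f\in\mathcal{H}$; it is a Bessel sequence with Bessel bound $B$ if at least the upper inequality holds. For a Bessel sequence $G$, $T_G:\ell^2\to\mathcal{H}$ is the bounded operator $T_G(\{c_n\}_{n=1}^\infty)=\sum_{n=1}^\infty c_ng_n$. $\mathcal{T}_L$ is the left shift on sequences, so $\mathcal{T}_L^2F=\{f_{n+2}\}_{n=1}^\infty$. $F$ is represented by $T_0$ if $T_0:\operatorname{span}\{f_n\}_{n=1}^\infty\to\operatorname{span}\{f_n\}_{n=1}^\infty$ is a linear (not necessarily bounded) operator with $f_n=T_0(f_{n-1}+f_{n-2})$ for all $n\geqslant 3$; $\operatorname{span}$ is the set of finite linear combinations. *)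

theory Defs
  imports "HOL-Analysis.Analysis" "Jordan_Normal_Form.Conjugate"
begin

(* Hilbert spaces over a scalar field 'k that is either the real or the complex numbers; the inner
   product is linear in its first argument.  By Gelfand-Mazur, a real_normed_field with the
   conjugation law mult_conjugate is a copy of one of these two fields, so that both cases are
   treated at once.  Completeness is part of the class banach. *)
locale hilbert_space = vector_space smul
  for smul :: "'k::{real_normed_field, conjugatable_field} \<Rightarrow> 'h::banach \<Rightarrow> 'h" +
  fixes ip :: "'h \<Rightarrow> 'h \<Rightarrow> 'k"
  assumes mult_conjugate: "a * conjugate a = of_real ((norm a)\<^sup>2)"
    and smul_of_real: "smul (of_real r) x = r *\<^sub>R x"
    and ip_add_left: "ip (x + y) z = ip x z + ip y z"
    and ip_smul_left: "ip (smul a x) z = a * ip x z"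
    and ip_commute: "ip y x = conjugate (ip x y)"
    and ip_self: "ip x x = of_real ((norm x)\<^sup>2)"

lemma hilbert_space_real:
  "hilbert_space (*\<^sub>R) (inner :: 'h::{real_inner, banach} \<Rightarrow> 'h \<Rightarrow> real)"
  by unfold_locales
    (auto simp: algebra_simps inner_add_left inner_commute dot_square_norm power2_eq_square)

lemma hilbert_space_complex: "hilbert_space (*) (\<lambda>x y. x * cnj y)"
  by unfold_locales
    (auto simp: algebra_simps scaleR_conv_of_real complex_norm_square[symmetric])

(* Sequences are indexed from 0: f n stands for the (n+1)-st member of the sequence. *)

definition ell2 :: "(nat \<Rightarrow> 'k::real_normed_field) set" where
  "ell2 = {c. summable (\<lambda>n. (norm (c n))\<^sup>2)}"

definition bessel_seq ::
    "('h::real_normed_vector \<Rightarrow> 'h \<Rightarrow> 'k::real_normed_field) \<Rightarrow> (nat \<Rightarrow> 'h) \<Rightarrow> real \<Rightarrow> bool" where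
  "bessel_seq ip g B \<longleftrightarrow> B > 0 \<and>
     (\<forall>x. summable (\<lambda>n. (norm (ip x (g n)))\<^sup>2) \<and>
          (\<Sum>n. (norm (ip x (g n)))\<^sup>2) \<le> B * (norm x)\<^sup>2)"

definition frame_seq ::
    "('h::real_normed_vector \<Rightarrow> 'h \<Rightarrow> 'k::real_normed_field) \<Rightarrow> (nat \<Rightarrow> 'h) \<Rightarrow> real \<Rightarrow> real \<Rightarrow> bool"
  where
  "frame_seq ip g A B \<longleftrightarrow> A > 0 \<and> bessel_seq ip g B \<and>
     (\<forall>x. A * (norm x)\<^sup>2 \<le> (\<Sum>n. (norm (ip x (g n)))\<^sup>2))"

(* Meaningful for c in ell2 and g a Bessel sequence, in which case the series converges. *)
definition synthesis ::
    "('k::real_normed_field \<Rightarrow> 'h::real_normed_vector \<Rightarrow> 'h) \<Rightarrow> (nat \<Rightarrow> 'h) \<Rightarrow> (nat \<Rightarrow> 'k) \<Rightarrow> 'h" where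
  "synthesis smul g c = (\<Sum>n. smul (c n) (g n))"

definition ker_synthesis ::
    "('k::real_normed_field \<Rightarrow> 'h::real_normed_vector \<Rightarrow> 'h) \<Rightarrow> (nat \<Rightarrow> 'h) \<Rightarrow> (nat \<Rightarrow> 'k) set" where
  "ker_synthesis smul g = {c \<in> ell2. synthesis smul g c = 0}"

definition left_shift :: "(nat \<Rightarrow> 'h) \<Rightarrow> nat \<Rightarrow> 'h" where
  "left_shift f = (\<lambda>n. f (Suc n))"

(* An operator with domain V is a total function of which only the values on V matter. *)
definition linear_operator_on ::
    "('k::real_normed_field \<Rightarrow> 'h::real_normed_vector \<Rightarrow> 'h) \<Rightarrow> 'h set \<Rightarrow> 'h set \<Rightarrow> ('h \<Rightarrow> 'h) \<Rightarrow> bool"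
  where
  "linear_operator_on smul V W T \<longleftrightarrow>
     (\<forall>x\<in>V. T x \<in> W) \<and>
     (\<forall>x\<in>V. \<forall>y\<in>V. T (x + y) = T x + T y) \<and>
     (\<forall>a. \<forall>x\<in>V. T (smul a x) = smul a (T x))"

definition represented_by ::
    "('k::real_normed_field \<Rightarrow> 'h::real_normed_vector \<Rightarrow> 'h) \<Rightarrow> (nat \<Rightarrow> 'h) \<Rightarrow> ('h \<Rightarrow> 'h) \<Rightarrow> bool" where
  "represented_by smul f T \<longleftrightarrow>
     linear_operator_on smul (module.span smul (range f)) (module.span smul (range f)) T \<and>
     (\<forall>n\<ge>2. f n = T (f (n - 1) + f (n - 2)))"

definition bounded_on :: "'h::real_normed_vector set \<Rightarrow> ('h \<Rightarrow> 'h) \<Rightarrow> bool" where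
  "bounded_on V T \<longleftrightarrow> (\<exists>K. \<forall>x\<in>V. norm (T x) \<le> K * norm x)"

(* The relative version of onorm; it is the operator norm of the restriction of T to V if T is
   linear and bounded on the subspace V (the quotient is 0 at x = 0). *)
definition onorm_on :: "'h::real_normed_vector set \<Rightarrow> ('h \<Rightarrow> 'h) \<Rightarrow> real" where
  "onorm_on V T = (SUP x\<in>V. norm (T x) / norm x)"

end

(* Represent x in span M both by a finite combination c and by its frame coefficients
   d = (ip (S^-1 x) (m n))_n, where S is the frame operator of M; then A_M ||d||^2 <= ||x||^2.
   The difference c - d lies in ker T_M, so the kernel inclusion lets T x be computed from d, and the
   Bessel bound gives ||T x||^2 <= B_F ||d||^2 <= (B_F / A_M) ||x||^2.  Conversely, a bounded T
   maps the partial sums of a null series sum c_n m_n to those of sum c_n f_(n+2). *)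

theory Submission
  imports Defs
begin

section \<open>Square-summable sequences and shifts of Bessel sequences\<close>

lemma ell2_add:
  assumes "c \<in> ell2" "d \<in> ell2"
  shows "(\<lambda>n. c n + d n) \<in> ell2"
proof -
  have "(norm (c n + d n))\<^sup>2 \<le> 2 * ((norm (c n))\<^sup>2 + (norm (d n))\<^sup>2)" for n
  proof -
    have "(norm (c n + d n))\<^sup>2 \<le> (norm (c n) + norm (d n))\<^sup>2"
      by (intro power_mono norm_triangle_ineq) simp
    also have "\<dots> \<le> 2 * ((norm (c n))\<^sup>2 + (norm (d n))\<^sup>2)"
      using sum_squares_bound[of "norm (c n)" "norm (d n)"] by (simp add: power2_sum)
    finally show ?thesis .
  qed
  then have "norm ((norm (c n + d n))\<^sup>2) \<le> 2 * ((norm (c n))\<^sup>2 + (norm (d n))\<^sup>2)" for n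
    by simp
  moreover have "summable (\<lambda>n. 2 * ((norm (c n))\<^sup>2 + (norm (d n))\<^sup>2))"
    using assms by (intro summable_mult summable_add) (auto simp: ell2_def)
  ultimately have "summable (\<lambda>n. (norm (c n + d n))\<^sup>2)"
    by (rule summable_comparison_test'[rotated])
  then show ?thesis
    by (simp add: ell2_def)
qed

lemma ell2_scale: "c \<in> ell2 \<Longrightarrow> (\<lambda>n. a * c n) \<in> ell2"
  using summable_mult[of "\<lambda>n. (norm (c n))\<^sup>2" "(norm a)\<^sup>2"]
  by (simp add: ell2_def norm_mult power_mult_distrib)

lemma ell2_diff:
  assumes "c \<in> ell2" "d \<in> ell2"
  shows "(\<lambda>n. c n - d n) \<in> ell2"
  using ell2_add[OF assms(1) ell2_scale[OF assms(2), of "- 1"]] by simp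

lemma ell2_single: "(\<lambda>n. if n = k then a else 0) \<in> ell2"
proof -
  have "summable (\<lambda>n. if n = k then (norm a)\<^sup>2 else 0)"
    by (rule sums_summable[OF sums_single[of k "\<lambda>_. (norm a)\<^sup>2"]])
  moreover have "(norm (if n = k then a else 0))\<^sup>2 = (if n = k then (norm a)\<^sup>2 else 0)" for n
    by simp
  ultimately show ?thesis
    unfolding ell2_def by simp
qed

lemma bessel_seq_ell2: "bessel_seq ip g B \<Longrightarrow> (\<lambda>n. ip x (g n)) \<in> ell2"
  by (simp add: bessel_seq_def ell2_def)

text \<open>Shifting only drops the first \<open>k\<close> nonnegative terms of the series, so the
  same constant \<open>B\<close> remains a Bessel bound.\<close>

lemma bessel_seq_shift:
  assumes "bessel_seq ip g B"
  shows "bessel_seq ip ((left_shift ^^ k) g) B"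
proof -
  have shift: "(left_shift ^^ k) g = (\<lambda>n. g (n + k))"
    by (induction k) (auto simp: left_shift_def)
  have "summable (\<lambda>n. (norm (ip x (g (n + k))))\<^sup>2) \<and>
      (\<Sum>n. (norm (ip x (g (n + k))))\<^sup>2) \<le> B * (norm x)\<^sup>2" for x
  proof -
    have s: "summable (\<lambda>n. (norm (ip x (g n)))\<^sup>2)"
      and b: "(\<Sum>n. (norm (ip x (g n)))\<^sup>2) \<le> B * (norm x)\<^sup>2"
      using assms by (auto simp: bessel_seq_def)
    have "0 \<le> (\<Sum>i<k. (norm (ip x (g i)))\<^sup>2)"
      by (simp add: sum_nonneg)
    then show ?thesis
      using b suminf_split_initial_segment[OF s, of k]
        summable_ignore_initial_segment[OF s, of k] by linarith
  qed
  then show ?thesis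
    using assms by (simp add: bessel_seq_def shift)
qed

section \<open>Inner product algebra and the Cauchy-Schwarz inequality\<close>

context hilbert_space
begin

text \<open>For \<open>r\<close> nonzero, \<open>mult_conjugate\<close> gives
  \<open>r * conjugate r = r * r\<close>, and \<open>r\<close> cancels.\<close>

lemma conjugate_of_real: "conjugate (of_real r :: 'k) = of_real r"
proof (cases "r = 0")
  case False
  have "of_real r * conjugate (of_real r :: 'k) = of_real r * of_real r"
    using mult_conjugate[of "of_real r"] by (simp add: power2_eq_square)
  with False show ?thesis by simp
qed simp

lemma norm_conjugate: "norm (conjugate a :: 'k) = norm a"
proof (cases "a = 0")
  case False
  have "norm a * norm (conjugate a) = norm a * norm a"
    using arg_cong[OF mult_conjugate[of a], of norm]
    by (simp add: norm_mult power2_eq_square)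
  with False show ?thesis by simp
qed simp

lemma norm_ip_commute: "norm (ip x y) = norm (ip y x)"
  by (metis ip_commute norm_conjugate)

lemma ip_add_right: "ip z (x + y) = ip z x + ip z y"
  by (metis ip_add_left ip_commute conjugate_dist_add)

lemma ip_smul_right: "ip z (smul a x) = conjugate a * ip z x"
  by (metis ip_smul_left ip_commute conjugate_dist_mul)

lemma ip_minus_left: "ip (- x) z = - ip x z"
  using ip_smul_left[of "- 1" x z] by simp

lemma ip_minus_right: "ip z (- x) = - ip z x"
  by (metis ip_minus_left ip_commute conjugate_neg)

lemma ip_diff_left: "ip (x - y) z = ip x z - ip y z"
  using ip_add_left[of x "- y" z] by (simp add: ip_minus_left)

lemma ip_diff_right: "ip z (x - y) = ip z x - ip z y"
  using ip_add_right[of z x "- y"] by (simp add: ip_minus_right)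

lemma ip_scaleR_left: "ip (r *\<^sub>R x) z = of_real r * ip x z"
  using ip_smul_left[of "of_real r" x z] by (simp add: smul_of_real)

lemma ip_scaleR_right: "ip z (r *\<^sub>R x) = of_real r * ip z x"
  using ip_smul_right[of z "of_real r" x] by (simp add: smul_of_real conjugate_of_real)

lemma ip_Cauchy_Schwarz: "norm (ip x y) \<le> norm x * norm y"
proof (cases "y = 0")
  case True
  then show ?thesis using ip_scaleR_right[of x 0 0] by simp
next
  case False
  define a where "a = ip x y"
  define n where "n = (norm y)\<^sup>2"
  \<comment> \<open>Up to the factor \<open>n\<close>, \<open>z\<close> is the component of
    \<open>x\<close> orthogonal to \<open>y\<close>. This scaling keeps division out of the
    expansion of \<open>ip z z\<close>.\<close>
  define z where "z = n *\<^sub>R x - smul a y"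
  have yx: "ip y x = conjugate a"
    by (simp add: a_def ip_commute[symmetric])
  have "ip z z = of_real n * (of_real n * ip x x) - of_real n * (a * conjugate a)"
    unfolding z_def
    by (simp add: ip_diff_left ip_diff_right ip_scaleR_left ip_scaleR_right ip_smul_left
        ip_smul_right yx ip_self[of y] n_def[symmetric] a_def[symmetric] algebra_simps)
  also have "\<dots> = of_real (n * (n * (norm x)\<^sup>2 - (norm a)\<^sup>2))"
    by (simp add: ip_self mult_conjugate algebra_simps)
  finally have "(norm z)\<^sup>2 = n * (n * (norm x)\<^sup>2 - (norm a)\<^sup>2)"
    by (metis ip_self of_real_eq_iff)
  then have "0 \<le> n * (n * (norm x)\<^sup>2 - (norm a)\<^sup>2)"
    by (metis zero_le_power2)
  moreover have "n > 0"
    using False by (simp add: n_def)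
  ultimately have "(norm a)\<^sup>2 \<le> n * (norm x)\<^sup>2"
    by (simp add: zero_le_mult_iff)
  then have "(norm a)\<^sup>2 \<le> (norm x * norm y)\<^sup>2"
    by (simp add: n_def power_mult_distrib mult.commute)
  then show ?thesis
    unfolding a_def by (rule power2_le_imp_le) simp
qed

lemma bounded_linear_ip_left: "bounded_linear (\<lambda>x. ip x z)"
  by (rule bounded_linear_intro[where K = "norm z"])
    (auto simp: ip_add_left ip_scaleR_left ip_Cauchy_Schwarz scaleR_conv_of_real)

lemma ip_sum_left: "ip (sum h I) z = (\<Sum>i\<in>I. ip (h i) z)"
  by (rule real_vector.linear_sum[OF bounded_linear.linear[OF bounded_linear_ip_left]])

section \<open>The synthesis operator of a Bessel sequence\<close>

text \<open>Duality: pairing the sum \<open>v\<close> with itself and applying Cauchy-Schwarz bounds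
  \<open>norm v\<close> to the fourth power by the square sum of \<open>c\<close> times that of the
  coefficients \<open>ip v (g n)\<close>. The Bessel inequality at \<open>v\<close> bounds the
  latter, and one factor \<open>(norm v)\<^sup>2\<close> cancels.\<close>

lemma bessel_seq_sum_bound:
  assumes "bessel_seq ip g B" "finite I"
  shows "(norm (\<Sum>n\<in>I. smul (c n) (g n)))\<^sup>2 \<le> B * (\<Sum>n\<in>I. (norm (c n))\<^sup>2)"
proof -
  define v where "v = (\<Sum>n\<in>I. smul (c n) (g n))"
  define C where "C = (\<Sum>n\<in>I. (norm (c n))\<^sup>2)"
  have "B > 0" and s: "summable (\<lambda>n. (norm (ip v (g n)))\<^sup>2)"
    and b: "(\<Sum>n. (norm (ip v (g n)))\<^sup>2) \<le> B * (norm v)\<^sup>2"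
    using assms(1) by (auto simp: bessel_seq_def)
  have "C \<ge> 0"
    by (simp add: C_def sum_nonneg)
  have "(norm v)\<^sup>2 = norm (ip v v)"
    by (simp add: ip_self norm_power)
  also have "ip v v = (\<Sum>n\<in>I. c n * ip (g n) v)"
    \<comment> \<open>Only the first argument is expanded; the second stays \<open>v\<close>, the
      vector at which the Bessel inequality is applied.\<close>
    by (subst (1) v_def) (simp add: ip_sum_left ip_smul_left)
  also have "norm \<dots> \<le> (\<Sum>n\<in>I. norm (c n) * norm (ip v (g n)))"
    by (rule sum_norm_le) (simp add: norm_mult norm_ip_commute)
  finally have "((norm v)\<^sup>2)\<^sup>2 \<le> (\<Sum>n\<in>I. norm (c n) * norm (ip v (g n)))\<^sup>2"
    by (rule power_mono) simp
  also have "\<dots> \<le> C * (\<Sum>n\<in>I. (norm (ip v (g n)))\<^sup>2)"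
    unfolding C_def by (rule Cauchy_Schwarz_ineq_sum)
  also have "\<dots> \<le> C * (B * (norm v)\<^sup>2)"
    using sum_le_suminf[OF s assms(2)] b \<open>C \<ge> 0\<close> by (intro mult_left_mono) auto
  finally have le: "(norm v)\<^sup>2 * (norm v)\<^sup>2 \<le> (B * C) * (norm v)\<^sup>2"
    by (simp add: power2_eq_square mult_ac)
  have "(norm v)\<^sup>2 \<le> B * C"
  proof (cases "v = 0")
    case False
    then show ?thesis
      by (intro mult_right_le_imp_le[OF le]) simp
  qed (use \<open>B > 0\<close> \<open>C \<ge> 0\<close> in simp)
  then show ?thesis
    by (simp add: v_def C_def)
qed

text \<open>The bound on finite sums, applied to the blocks \<open>{m..<n}\<close>, carries the
  Cauchy criterion over from the squares of \<open>c\<close> to the vectors; completeness then gives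
  convergence.\<close>

lemma bessel_seq_summable:
  assumes "bessel_seq ip g B" "c \<in> ell2"
  shows "summable (\<lambda>n. smul (c n) (g n))"
  unfolding summable_Cauchy
proof (intro allI impI)
  fix e :: real
  assume "e > 0"
  have "B > 0" using assms(1) by (simp add: bessel_seq_def)
  then have "e\<^sup>2 / B > 0" using \<open>e > 0\<close> by simp
  moreover have "summable (\<lambda>n. (norm (c n))\<^sup>2)"
    using assms(2) by (simp add: ell2_def)
  ultimately obtain N where N: "\<And>m n. m \<ge> N \<Longrightarrow> norm (\<Sum>i\<in>{m..<n}. (norm (c i))\<^sup>2) < e\<^sup>2 / B"
    unfolding summable_Cauchy by blast
  have "norm (\<Sum>i\<in>{m..<n}. smul (c i) (g i)) < e" if "m \<ge> N" for m n
  proof -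
    have "(norm (\<Sum>i\<in>{m..<n}. smul (c i) (g i)))\<^sup>2 \<le> B * (\<Sum>i\<in>{m..<n}. (norm (c i))\<^sup>2)"
      by (rule bessel_seq_sum_bound[OF assms(1)]) simp
    also have "\<dots> < e\<^sup>2"
      using N[OF that, of n] \<open>B > 0\<close> by (simp add: sum_nonneg field_simps)
    finally show ?thesis
      using \<open>e > 0\<close> by (intro power2_less_imp_less[of _ e]) auto
  qed
  then show "\<exists>N. \<forall>m\<ge>N. \<forall>n. norm (\<Sum>i\<in>{m..<n}. smul (c i) (g i)) < e"
    by blast
qed

lemma bessel_seq_sums:
  assumes "bessel_seq ip g B" "c \<in> ell2"
  shows "(\<lambda>n. smul (c n) (g n)) sums synthesis smul g c"
  unfolding synthesis_def by (rule summable_sums[OF bessel_seq_summable[OF assms]])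

lemma synthesis_bound:
  assumes "bessel_seq ip g B" "c \<in> ell2"
  shows "(norm (synthesis smul g c))\<^sup>2 \<le> B * (\<Sum>n. (norm (c n))\<^sup>2)"
proof (rule LIMSEQ_le)
  show "(\<lambda>N. (norm (\<Sum>n<N. smul (c n) (g n)))\<^sup>2) \<longlonglongrightarrow> (norm (synthesis smul g c))\<^sup>2"
    using bessel_seq_sums[OF assms] unfolding sums_def by (intro tendsto_intros)
  have "(\<lambda>n. (norm (c n))\<^sup>2) sums (\<Sum>n. (norm (c n))\<^sup>2)"
    using assms(2) by (simp add: ell2_def summable_sums)
  then show "(\<lambda>N. B * (\<Sum>n<N. (norm (c n))\<^sup>2)) \<longlonglongrightarrow> B * (\<Sum>n. (norm (c n))\<^sup>2)"
    unfolding sums_def by (intro tendsto_intros)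
  show "\<exists>N. \<forall>n\<ge>N. (norm (\<Sum>n<n. smul (c n) (g n)))\<^sup>2 \<le> B * (\<Sum>n<n. (norm (c n))\<^sup>2)"
    using bessel_seq_sum_bound[OF assms(1)] by blast
qed

lemma synthesis_diff:
  assumes "bessel_seq ip g B" "c \<in> ell2" "d \<in> ell2"
  shows "synthesis smul g (\<lambda>n. c n - d n) = synthesis smul g c - synthesis smul g d"
  using sums_unique[OF sums_diff[OF bessel_seq_sums[OF assms(1,2)] bessel_seq_sums[OF assms(1,3)]]]
  unfolding synthesis_def scale_left_diff_distrib by (rule sym)

section \<open>The frame operator and norm-controlled coefficients\<close>

text \<open>Pairing the series termwise with \<open>x\<close> turns each term into a coefficient
  times its conjugate. Hence the quadratic form of the frame operator is real, and the frame
  inequalities become bounds on it.\<close>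

lemma ip_frame_operator:
  assumes "bessel_seq ip g B"
  shows "ip (synthesis smul g (\<lambda>n. ip x (g n))) x = of_real (\<Sum>n. (norm (ip x (g n)))\<^sup>2)"
proof -
  have "(\<lambda>n. ip (smul (ip x (g n)) (g n)) x) sums ip (synthesis smul g (\<lambda>n. ip x (g n))) x"
    by (intro bounded_linear.sums[OF bounded_linear_ip_left] bessel_seq_sums[OF assms]
        bessel_seq_ell2[OF assms])
  moreover have "ip (smul (ip x (g n)) (g n)) x = of_real ((norm (ip x (g n)))\<^sup>2)" for n
    by (simp add: ip_smul_left ip_commute[of "g n" x] mult_conjugate del: of_real_power)
  moreover have "(\<lambda>n. of_real ((norm (ip x (g n)))\<^sup>2) :: 'k) sums
      of_real (\<Sum>n. (norm (ip x (g n)))\<^sup>2)"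
    using assms by (intro sums_of_real summable_sums) (simp add: bessel_seq_def)
  ultimately show ?thesis
    using sums_unique2 by fastforce
qed

text \<open>With \<open>S\<close> the frame operator, \<open>x - S x / B\<close> is a contraction because
  \<open>(norm (S x))\<^sup>2 \<le> B * ip (S x) x\<close> and \<open>A * (norm x)\<^sup>2 \<le> ip (S x) x\<close>.\<close>

lemma frame_operator_surj:
  assumes "frame_seq ip g A B"
  obtains y where "synthesis smul g (\<lambda>n. ip y (g n)) = x"
proof -
  have "A > 0" and bessel: "bessel_seq ip g B"
    and lower: "A * (norm w)\<^sup>2 \<le> (\<Sum>n. (norm (ip w (g n)))\<^sup>2)" for w
    using assms by (auto simp: frame_seq_def)
  have "B > 0" using bessel by (simp add: bessel_seq_def)
  define S where "S = (\<lambda>w. synthesis smul g (\<lambda>n. ip w (g n)))"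
  \<comment> \<open>The maximum keeps \<open>sqrt q\<close> a legitimate contraction constant even
    if \<open>A > B\<close>, which can happen in the zero space.\<close>
  define q where "q = max 0 (1 - A / B)"
  \<comment> \<open>The fixed points of \<open>\<phi>\<close> are exactly the solutions of
    \<open>S y = x\<close>. The vector \<open>x\<close> cancels in differences, so only the linear
    part \<open>w - S w / B\<close> has to contract.\<close>
  define \<phi> where "\<phi> = (\<lambda>w. w + (1 / B) *\<^sub>R (x - S w))"
  have S_diff: "S (u - v) = S u - S v" for u v
    by (simp add: S_def ip_diff_left synthesis_diff[OF bessel] bessel_seq_ell2[OF bessel])
  have contract: "(norm (w - (1 / B) *\<^sub>R S w))\<^sup>2 \<le> q * (norm w)\<^sup>2" for w
  proof -
    define r where "r = (\<Sum>n. (norm (ip w (g n)))\<^sup>2)"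
    have Sw: "ip (S w) w = of_real r"
      unfolding S_def r_def by (rule ip_frame_operator[OF bessel])
    then have wS: "ip w (S w) = of_real r"
      by (metis ip_commute conjugate_of_real)
    have "ip (w - (1 / B) *\<^sub>R S w) (w - (1 / B) *\<^sub>R S w) =
        of_real ((norm w)\<^sup>2 - 2 * r / B + (norm (S w))\<^sup>2 / B\<^sup>2)"
      by (simp add: ip_diff_left ip_diff_right ip_scaleR_left ip_scaleR_right Sw wS
          ip_self[of w] ip_self[of "S w"] power2_eq_square add_divide_distrib algebra_simps)
    then have "(norm (w - (1 / B) *\<^sub>R S w))\<^sup>2 = (norm w)\<^sup>2 - 2 * r / B + (norm (S w))\<^sup>2 / B\<^sup>2"
      by (metis ip_self of_real_eq_iff)
    also have "\<dots> \<le> (norm w)\<^sup>2 - 2 * r / B + (B * r) / B\<^sup>2"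
      using synthesis_bound[OF bessel bessel_seq_ell2[OF bessel], of w]
      by (intro add_left_mono divide_right_mono) (simp_all add: S_def r_def)
    also have "\<dots> = (norm w)\<^sup>2 - r / B"
      using \<open>B > 0\<close> by (simp add: field_simps power2_eq_square)
    also have "\<dots> \<le> (norm w)\<^sup>2 - A * (norm w)\<^sup>2 / B"
      using lower[of w] \<open>B > 0\<close> by (simp add: r_def divide_right_mono)
    also have "\<dots> = (1 - A / B) * (norm w)\<^sup>2"
      by (simp add: algebra_simps)
    also have "\<dots> \<le> q * (norm w)\<^sup>2"
      by (intro mult_right_mono) (auto simp: q_def)
    finally show ?thesis .
  qed
  have "\<exists>!y. \<phi> y = y"
  proof (rule banach_fix_type)
    show "0 \<le> sqrt q" "sqrt q < 1"
      using \<open>A > 0\<close> \<open>B > 0\<close> by (auto simp: q_def)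
    show "\<forall>u v. dist (\<phi> u) (\<phi> v) \<le> sqrt q * dist u v"
    proof (intro allI)
      fix u v
      have "\<phi> u - \<phi> v = (u - v) - (1 / B) *\<^sub>R S (u - v)"
        by (simp add: \<phi>_def S_diff algebra_simps)
      then have "dist (\<phi> u) (\<phi> v) = norm ((u - v) - (1 / B) *\<^sub>R S (u - v))"
        by (simp add: dist_norm)
      also have "\<dots> \<le> sqrt (q * (norm (u - v))\<^sup>2)"
        by (rule real_le_rsqrt[OF contract])
      finally show "dist (\<phi> u) (\<phi> v) \<le> sqrt q * dist u v"
        by (simp add: real_sqrt_mult dist_norm)
    qed
  qed
  then obtain y where "\<phi> y = y" by blast
  then have "S y = x"
    using \<open>B > 0\<close> by (simp add: \<phi>_def)
  then show thesis
    using that by (simp add: S_def)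
qed

text \<open>The coefficients are \<open>ip y (g n)\<close> with \<open>y\<close> a preimage of
  \<open>x\<close> under the frame operator. Their square sum \<open>r\<close> equals
  \<open>ip x y\<close>, so \<open>r \<le> norm x * norm y\<close>; squaring and inserting
  \<open>A * (norm y)\<^sup>2 \<le> r\<close> gives
  \<open>A * r\<^sup>2 \<le> (norm x)\<^sup>2 * r\<close>.\<close>

lemma frame_coefficients_bound:
  assumes "frame_seq ip g A B"
  obtains c where "c \<in> ell2" "synthesis smul g c = x" "A * (\<Sum>n. (norm (c n))\<^sup>2) \<le> (norm x)\<^sup>2"
proof -
  have "A > 0" and bessel: "bessel_seq ip g B"
    and lower: "A * (norm w)\<^sup>2 \<le> (\<Sum>n. (norm (ip w (g n)))\<^sup>2)" for w
    using assms by (auto simp: frame_seq_def)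
  obtain y where y: "synthesis smul g (\<lambda>n. ip y (g n)) = x"
    using frame_operator_surj[OF assms] .
  define r where "r = (\<Sum>n. (norm (ip y (g n)))\<^sup>2)"
  have "r \<ge> 0"
    using bessel unfolding r_def by (intro suminf_nonneg) (auto simp: bessel_seq_def)
  have "ip x y = of_real r"
    using ip_frame_operator[OF bessel, of y] by (simp add: y r_def)
  then have "r \<le> norm x * norm y"
    using ip_Cauchy_Schwarz[of x y] \<open>r \<ge> 0\<close> by simp
  then have "A * r\<^sup>2 \<le> A * (norm x * norm y)\<^sup>2"
    using \<open>A > 0\<close> \<open>r \<ge> 0\<close> by (intro mult_left_mono power_mono) auto
  also have "\<dots> = (norm x)\<^sup>2 * (A * (norm y)\<^sup>2)"
    by (simp add: power_mult_distrib)
  also have "\<dots> \<le> (norm x)\<^sup>2 * r"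
    unfolding r_def by (intro mult_left_mono lower) simp
  finally have "(A * r) * r \<le> (norm x)\<^sup>2 * r"
    by (simp add: power2_eq_square mult.assoc)
  then have "A * r \<le> (norm x)\<^sup>2"
    using \<open>r \<ge> 0\<close> by (cases "r = 0") auto
  then show thesis
    using that[OF bessel_seq_ell2[OF bessel] y] by (simp add: r_def)
qed

section \<open>Linear operators on subspaces and finite combinations\<close>

lemma linear_operator_on_sum:
  assumes "linear_operator_on smul V W T" "subspace V" "\<And>i. i \<in> I \<Longrightarrow> g i \<in> V"
  shows "T (\<Sum>i\<in>I. smul (c i) (g i)) = (\<Sum>i\<in>I. smul (c i) (T (g i)))"
proof -
  \<comment> \<open>This settles both the empty and the infinite index set, where the sums take the
    value \<open>0\<close>.\<close>
  have T0: "T 0 = 0"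
    using assms(1) subspace_0[OF assms(2)] scale_zero_left unfolding linear_operator_on_def by metis
  show ?thesis
    using assms(3)
  proof (induction I rule: infinite_finite_induct)
    case (insert i I)
    have "smul (c i) (g i) \<in> V" "(\<Sum>i\<in>I. smul (c i) (g i)) \<in> V" "g i \<in> V"
      using insert.prems by (auto intro!: subspace_sum subspace_scale assms(2))
    then show ?case
      using insert assms(1) by (simp add: linear_operator_on_def)
  qed (simp_all add: T0)
qed

text \<open>A finite combination is recorded as a sequence in \<open>ell2\<close> whose series
  converges to \<open>x\<close>, so that it can be subtracted from frame coefficients. The same
  sequence must represent \<open>T x\<close> through the images \<open>T (g n)\<close>.\<close>

lemma span_range_ell2_representation:
  assumes "linear_operator_on smul V W T" "subspace V" "range g \<subseteq> V" "x \<in> span (range g)"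
  shows "\<exists>c\<in>ell2. (\<lambda>n. smul (c n) (g n)) sums x \<and> (\<lambda>n. smul (c n) (T (g n))) sums T x"
proof -
  have add: "T (u + v) = T u + T v" and scale: "T (smul a u) = smul a (T u)"
    if "u \<in> V" "v \<in> V" for a u v
    using assms(1) that by (auto simp: linear_operator_on_def)
  have "0 \<in> V" using assms(2) by (rule subspace_0)
  \<comment> \<open>Membership in \<open>V\<close> is carried through the induction because
    \<open>T\<close> is additive only there.\<close>
  have "x \<in> V \<and> (\<exists>c\<in>ell2. (\<lambda>n. smul (c n) (g n)) sums x \<and> (\<lambda>n. smul (c n) (T (g n))) sums T x)"
    using assms(4)
  proof (induction rule: span_induct_alt)
    case base
    have "T 0 = 0"
      using scale[OF \<open>0 \<in> V\<close> \<open>0 \<in> V\<close>, of 0] by simp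
    moreover have "(\<lambda>_. 0) \<in> ell2"
      by (simp add: ell2_def)
    ultimately show ?case
      using \<open>0 \<in> V\<close> by (intro conjI bexI[of _ "\<lambda>_. 0"]) simp_all
  next
    case (step a z y)
    then obtain k c where z: "z = g k" and c: "c \<in> ell2" "(\<lambda>n. smul (c n) (g n)) sums y"
      "(\<lambda>n. smul (c n) (T (g n))) sums T y" and "y \<in> V"
      by blast
    define d where "d = (\<lambda>n. if n = k then a else 0)"
    have "g k \<in> V" using assms(3) by blast
    \<comment> \<open>Stated for every \<open>h\<close>, since it is applied both to
      \<open>g\<close> and to the images \<open>T (g n)\<close>.\<close>
    have d: "(\<lambda>n. smul (d n) (h n)) sums smul a (h k)" for h
    proof -
      have "smul (d n) (h n) = (if n = k then smul a (h n) else 0)" for n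
        by (simp add: d_def)
      then show ?thesis
        using sums_single[of k "\<lambda>n. smul a (h n)"] by presburger
    qed
    have "smul a (g k) \<in> V"
      using \<open>g k \<in> V\<close> by (rule subspace_scale[OF assms(2)])
    then have "smul a z + y \<in> V" "T (smul a z + y) = smul a (T (g k)) + T y"
      using \<open>y \<in> V\<close> \<open>g k \<in> V\<close> by (auto simp: z add scale subspace_add[OF assms(2)])
    moreover have "(\<lambda>n. smul (d n + c n) (g n)) sums (smul a z + y)"
      using sums_add[OF d c(2)] by (simp add: z scale_left_distrib)
    moreover have "(\<lambda>n. smul (d n + c n) (T (g n))) sums (smul a (T (g k)) + T y)"
      using sums_add[OF d c(3)] by (simp add: scale_left_distrib)
    moreover have "(\<lambda>n. d n + c n) \<in> ell2"
      unfolding d_def by (intro ell2_add ell2_single c(1))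
    ultimately show ?case by auto
  qed
  then show ?thesis by blast
qed

section \<open>Kernel inclusion and the operator bound\<close>

text \<open>The recursion enters the proposition only through the fact that the shifted sequence is
  the image of the frame under a linear operator; here that image is an arbitrary Bessel sequence
  \<open>T (g n)\<close>.\<close>

lemma ker_synthesis_subset_iff_bounded:
  assumes frame: "frame_seq ip g A B'" and bessel: "bessel_seq ip (\<lambda>n. T (g n)) B"
    and T: "linear_operator_on smul V W T" "subspace V" "range g \<subseteq> V"
  shows "ker_synthesis smul g \<subseteq> ker_synthesis smul (\<lambda>n. T (g n)) \<longleftrightarrow>
    bounded_on (span (range g)) T \<and> onorm_on (span (range g)) T \<le> sqrt (B / A)"
    (is "?lhs \<longleftrightarrow> ?rhs")
proof
  have "A > 0" and bessel_g: "bessel_seq ip g B'"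
    using frame by (auto simp: frame_seq_def)
  have "B > 0" using bessel by (simp add: bessel_seq_def)
  {
    assume ker: ?lhs
    have bound: "norm (T x) \<le> sqrt (B / A) * norm x" if x: "x \<in> span (range g)" for x
    proof -
      \<comment> \<open>The two representations have different merits: \<open>c\<close> is
        compatible with \<open>T\<close>, while \<open>d\<close> has square sum at most
        \<open>(norm x)\<^sup>2 / A\<close>. The kernel inclusion lets \<open>d\<close> replace
        \<open>c\<close> in the formula for \<open>T x\<close>.\<close>
      obtain c where c: "c \<in> ell2" "(\<lambda>n. smul (c n) (g n)) sums x"
        "(\<lambda>n. smul (c n) (T (g n))) sums T x"
        using span_range_ell2_representation[OF T x] by blast
      obtain d where d: "d \<in> ell2" "synthesis smul g d = x"
        "A * (\<Sum>n. (norm (d n))\<^sup>2) \<le> (norm x)\<^sup>2"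
        using frame_coefficients_bound[OF frame] .
      have "synthesis smul g c = x" "synthesis smul (\<lambda>n. T (g n)) c = T x"
        using c by (auto simp: synthesis_def sums_iff)
      then have "(\<lambda>n. c n - d n) \<in> ker_synthesis smul g"
        using c(1) d by (simp add: ker_synthesis_def ell2_diff synthesis_diff[OF bessel_g])
      then have "(\<lambda>n. c n - d n) \<in> ker_synthesis smul (\<lambda>n. T (g n))"
        using ker by blast
      then have "T x = synthesis smul (\<lambda>n. T (g n)) d"
        using synthesis_diff[OF bessel c(1) d(1)] \<open>synthesis smul (\<lambda>n. T (g n)) c = T x\<close>
        by (simp add: ker_synthesis_def)
      then have "(norm (T x))\<^sup>2 \<le> B * (\<Sum>n. (norm (d n))\<^sup>2)"
        using synthesis_bound[OF bessel d(1)] by simp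
      also have "\<dots> \<le> B * ((norm x)\<^sup>2 / A)"
        using d(3) \<open>A > 0\<close> \<open>B > 0\<close> by (intro mult_left_mono) (auto simp: field_simps)
      finally have "norm (T x) \<le> sqrt (B / A * (norm x)\<^sup>2)"
        by (intro real_le_rsqrt) simp
      then show ?thesis by (simp only: real_sqrt_mult real_sqrt_abs abs_norm_cancel)
    qed
    have "onorm_on (span (range g)) T \<le> sqrt (B / A)"
      unfolding onorm_on_def
    proof (rule cSUP_least)
      show "span (range g) \<noteq> {}" using span_zero by blast
      \<comment> \<open>At \<open>x = 0\<close> the quotient is \<open>0\<close> by the convention
        for division, hence below the nonnegative bound.\<close>
      show "norm (T x) / norm x \<le> sqrt (B / A)" if "x \<in> span (range g)" for x
        using bound[OF that] \<open>A > 0\<close> \<open>B > 0\<close> by (cases "x = 0") (auto simp: divide_le_eq)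
    qed
    then show ?rhs
      using bound by (auto simp: bounded_on_def)
  }
  assume ?rhs
  then obtain K where K: "\<And>x. x \<in> span (range g) \<Longrightarrow> norm (T x) \<le> K * norm x"
    by (auto simp: bounded_on_def)
  show ?lhs
  proof
    fix c assume "c \<in> ker_synthesis smul g"
    then have c: "c \<in> ell2" and "synthesis smul g c = 0"
      by (auto simp: ker_synthesis_def)
    then have lim: "(\<lambda>N. \<Sum>n<N. smul (c n) (g n)) \<longlonglongrightarrow> 0"
      using bessel_seq_sums[OF bessel_g c] by (simp add: sums_def)
    \<comment> \<open>The full series may leave the span, but its partial sums do not;
      \<open>T\<close> is applied to these alone, and the estimate then passes to the limit.\<close>
    have "norm (\<Sum>n<N. smul (c n) (T (g n))) \<le> K * norm (\<Sum>n<N. smul (c n) (g n))" for N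
    proof -
      have "(\<Sum>n<N. smul (c n) (T (g n))) = T (\<Sum>n<N. smul (c n) (g n))"
        using T by (intro linear_operator_on_sum[symmetric]) auto
      moreover have "(\<Sum>n<N. smul (c n) (g n)) \<in> span (range g)"
        by (intro span_sum span_scale span_base) auto
      ultimately show ?thesis using K by simp
    qed
    moreover have "(\<lambda>N. K * norm (\<Sum>n<N. smul (c n) (g n))) \<longlonglongrightarrow> 0"
      using tendsto_mult_left[OF tendsto_norm[OF lim], of K] by simp
    ultimately have "(\<lambda>N. \<Sum>n<N. smul (c n) (T (g n))) \<longlonglongrightarrow> 0"
      by (rule Lim_null_comparison[OF always_eventually[OF allI]])
    then have "(\<lambda>n. smul (c n) (T (g n))) sums 0"
      by (simp add: sums_def)
    then have "synthesis smul (\<lambda>n. T (g n)) c = 0"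
      unfolding synthesis_def by (rule sums_unique[symmetric])
    then show "c \<in> ker_synthesis smul (\<lambda>n. T (g n))"
      using c by (simp add: ker_synthesis_def)
  qed
qed

end

theorem proposition4p4:
  fixes smul :: "'k::{real_normed_field, conjugatable_field} \<Rightarrow> 'h::banach \<Rightarrow> 'h"
    and ip :: "'h \<Rightarrow> 'h \<Rightarrow> 'k"
    and f m :: "nat \<Rightarrow> 'h"
    and T0 :: "'h \<Rightarrow> 'h"
    and B_F A_M B_M :: real
  assumes "hilbert_space smul ip"
    and "bessel_seq ip f B_F"
    and "represented_by smul f T0"
    and "m = (\<lambda>n. f n + f (n + 1))"
    and "frame_seq ip m A_M B_M"
  shows "ker_synthesis smul m \<subseteq> ker_synthesis smul ((left_shift ^^ 2) f) \<longleftrightarrow>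
         bounded_on (module.span smul (range m)) T0 \<and>
         onorm_on (module.span smul (range m)) T0 \<le> sqrt (B_F / A_M)"
proof -
  interpret hilbert_space smul ip by fact
  have lin: "linear_operator_on smul (span (range f)) (span (range f)) T0"
    and rec: "\<And>n. n \<ge> 2 \<Longrightarrow> f n = T0 (f (n - 1) + f (n - 2))"
    using assms(3) by (auto simp: represented_by_def)
  \<comment> \<open>With indices starting at \<open>0\<close>, the recursion at \<open>n + 2\<close>
    reads \<open>f (n + 2) = T0 (f (n + 1) + f n)\<close>, whose argument is
    \<open>m n\<close>.\<close>
  have "(left_shift ^^ 2) f = (\<lambda>n. T0 (m n))"
  proof
    show "(left_shift ^^ 2) f n = T0 (m n)" for n
      using rec[of "n + 2"]
      by (simp add: assms(4) left_shift_def eval_nat_numeral add.commute)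
  qed
  moreover have "range m \<subseteq> span (range f)"
    by (auto simp: assms(4) intro: span_add span_base)
  ultimately show ?thesis
    using ker_synthesis_subset_iff_bounded[OF assms(5) _ lin subspace_span]
      bessel_seq_shift[OF assms(2), of 2] by simp
qed

end
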